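(* The even Weyl groups of the hyperbolic Kac--Moody algebras $B_8^{++}$ and $D_8^{++}$ satisfy $$W^+(B_8^{++})\cong W^+(D_8^{++})\rtimes 2.$$
   Context: For a Kac--Moody algebra with Cartan matrix $[A_{IJ}]$, the Weyl group $W$ is the Coxeter group with generators $w_I$ and relations $w_I^2=1$, $(w_Iw_J)^{m_{IJ}}=1$ for $I\ne J$, where $m_{IJ}=2,3,4,6,\infty$ according as $A_{IJ}A_{JI}=0,1,2,3,\ge4$. $W^+\subset W$ is the index 2 subgroup of products of an even number of generators. $X^{++}$ denotes the over-extension of the finite type $X$ (the untwisted affine extension with one more node $-1$ attached by a single line to the affine node $0$). Both diagrams have nodes $-1,0,1,\dots,8$. For $D_8^{++}$: $m_{IJ}=3$ exactly for $\{-1,0\},\{0,1\},\{1,2\},\{2,3\},\{3,4\},\{4,5\},\{5,6\},\{1,7\},\{5,8\}$, and $m_{IJ}=2$ for the other pairs. For $B_8^{++}$: $m_{IJ}=3$ for $\{-1,0\},\{0,1\},\{1,2\},\{2,3\},\{3,4\},\{4,5\},\{5,6\},\{1,7\}$, $m_{6,8}=4$, and $m_{IJ}=2$ for the other pairs. The notation $A\rtimes 2$ means a semi-direct product of $A$ with $\mathbb{Z}/2\mathbb{Z}$: a group with a normal subgroup isomorphic to $A$ of index 2 and a complementary subgroup of order 2, acting on $A$ by conjugation as automorphisms. *)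

theory Defs
  imports "HOL-Algebra.Coset" "HOL-Library.Extended_Nat"
begin

section \<open>Groups given by generators and relators\<close>

text \<open>
  A letter \<open>(x, True)\<close> stands for the generator \<open>x\<close>, and \<open>(x, False)\<close> for its formal inverse.
\<close>

type_synonym 'a group_word = "('a \<times> bool) list"

definition group_words :: "'a set \<Rightarrow> 'a group_word set" where
  "group_words S = {u. fst ` set u \<subseteq> S}"

lemma group_words_simps [simp]:
  "[] \<in> group_words S"
  "a # u \<in> group_words S \<longleftrightarrow> fst a \<in> S \<and> u \<in> group_words S"
  "u @ v \<in> group_words S \<longleftrightarrow> u \<in> group_words S \<and> v \<in> group_words S"
  "rev u \<in> group_words S \<longleftrightarrow> u \<in> group_words S"
  "map (\<lambda>(x, b). (x, \<not> b)) u \<in> group_words S \<longleftrightarrow> u \<in> group_words S"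
  "map (\<lambda>i. (i, b)) is \<in> group_words S \<longleftrightarrow> set is \<subseteq> S"
  by (auto simp: group_words_def image_iff) force+

inductive word_eq :: "'a set \<Rightarrow> 'a group_word set \<Rightarrow> 'a group_word \<Rightarrow> 'a group_word \<Rightarrow> bool"
  for S :: "'a set" and R :: "'a group_word set"
where
  refl: "u \<in> group_words S \<Longrightarrow> word_eq S R u u"
| sym: "word_eq S R u v \<Longrightarrow> word_eq S R v u"
| trans: "word_eq S R u v \<Longrightarrow> word_eq S R v w \<Longrightarrow> word_eq S R u w"
| append: "word_eq S R u u' \<Longrightarrow> word_eq S R v v' \<Longrightarrow> word_eq S R (u @ v) (u' @ v')"
| cancel: "x \<in> S \<Longrightarrow> word_eq S R [(x, b), (x, \<not> b)] []"
| relator: "r \<in> R \<Longrightarrow> r \<in> group_words S \<Longrightarrow> word_eq S R r []"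

definition word_class :: "'a set \<Rightarrow> 'a group_word set \<Rightarrow> 'a group_word \<Rightarrow> 'a group_word set" where
  "word_class S R u = {v. word_eq S R u v}"

definition presented_group :: "'a set \<Rightarrow> 'a group_word set \<Rightarrow> 'a group_word set monoid" where
  "presented_group S R =
     \<lparr>carrier = word_class S R ` group_words S,
      mult = (\<lambda>X Y. \<Union>u\<in>X. \<Union>v\<in>Y. word_class S R (u @ v)),
      one = word_class S R []\<rparr>"

lemma word_class_eq_iff:
  assumes "u \<in> group_words S"
  shows "word_class S R u = word_class S R v \<longleftrightarrow> word_eq S R u v"
proof
  assume "word_class S R u = word_class S R v"
  then have "u \<in> word_class S R v"
    using assms word_eq.refl[of u S R] by (auto simp: word_class_def)
  then show "word_eq S R u v"
    by (auto simp: word_class_def intro: word_eq.sym)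
next
  assume "word_eq S R u v"
  then show "word_class S R u = word_class S R v"
    unfolding word_class_def by (blast intro: word_eq.sym word_eq.trans)
qed

lemma mult_word_class:
  assumes "u \<in> group_words S" "v \<in> group_words S"
  shows "word_class S R u \<otimes>\<^bsub>presented_group S R\<^esub> word_class S R v = word_class S R (u @ v)"
proof -
  have *: "word_class S R (u' @ v') = word_class S R (u @ v)"
    if "u' \<in> word_class S R u" "v' \<in> word_class S R v" for u' v'
  proof -
    have "word_eq S R (u @ v) (u' @ v')"
      using that by (auto simp: word_class_def intro: word_eq.append)
    then show ?thesis
      using assms word_class_eq_iff[of "u @ v" S R "u' @ v'"] by simp
  qed
  have "u \<in> word_class S R u" "v \<in> word_class S R v"
    using assms by (simp_all add: word_class_def word_eq.refl)
  then have ne: "word_class S R u \<noteq> {}" "word_class S R v \<noteq> {}"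
    by blast+
  have "word_class S R u \<otimes>\<^bsub>presented_group S R\<^esub> word_class S R v =
      (\<Union>u'\<in>word_class S R u. \<Union>v'\<in>word_class S R v. word_class S R (u @ v))"
    by (simp add: presented_group_def * cong: SUP_cong)
  also have "\<dots> = word_class S R (u @ v)"
    using ne by simp
  finally show ?thesis .
qed

lemma word_inverse:
  assumes "u \<in> group_words S"
  shows "word_eq S R (rev (map (\<lambda>(x, b). (x, \<not> b)) u) @ u) []"
  using assms
proof (induction u)
  case Nil
  then show ?case by (simp add: word_eq.refl)
next
  case (Cons a u)
  obtain x b where a: "a = (x, b)" by (cases a)
  let ?v = "rev (map (\<lambda>(x, b). (x, \<not> b)) u)"
  have x: "x \<in> S" and u: "u \<in> group_words S" using Cons.prems a by auto
  have v: "?v \<in> group_words S" using u by auto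
  have "word_eq S R ([(x, \<not> b), (x, b)] @ u) ([] @ u)"
    using word_eq.append[OF word_eq.cancel[OF x, of R "\<not> b"] word_eq.refl[OF u, of R]] by simp
  then have "word_eq S R (?v @ ([(x, \<not> b), (x, b)] @ u)) (?v @ ([] @ u))"
    by (rule word_eq.append[OF word_eq.refl[OF v]])
  moreover have "word_eq S R (?v @ ([] @ u)) []"
    using Cons.IH u by simp
  ultimately have "word_eq S R (?v @ ([(x, \<not> b), (x, b)] @ u)) []"
    by (rule word_eq.trans)
  then show ?case by (simp add: a)
qed

lemma group_presented_group: "group (presented_group S R)"
proof (rule groupI)
  let ?G = "presented_group S R"
  have carr: "carrier ?G = word_class S R ` group_words S"
    and one: "\<one>\<^bsub>?G\<^esub> = word_class S R []"
    by (simp_all add: presented_group_def)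
  show "\<one>\<^bsub>?G\<^esub> \<in> carrier ?G"
    by (auto simp: carr one)
  show "x \<otimes>\<^bsub>?G\<^esub> y \<in> carrier ?G" if "x \<in> carrier ?G" "y \<in> carrier ?G" for x y
    using that unfolding carr by (elim imageE) (simp add: mult_word_class)
  show "x \<otimes>\<^bsub>?G\<^esub> y \<otimes>\<^bsub>?G\<^esub> z = x \<otimes>\<^bsub>?G\<^esub> (y \<otimes>\<^bsub>?G\<^esub> z)"
    if "x \<in> carrier ?G" "y \<in> carrier ?G" "z \<in> carrier ?G" for x y z
    using that unfolding carr by (elim imageE) (simp add: mult_word_class)
  show "\<one>\<^bsub>?G\<^esub> \<otimes>\<^bsub>?G\<^esub> x = x" if "x \<in> carrier ?G" for x
    using that unfolding carr one by (elim imageE) (simp add: mult_word_class)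
  show "\<exists>y\<in>carrier ?G. y \<otimes>\<^bsub>?G\<^esub> x = \<one>\<^bsub>?G\<^esub>" if "x \<in> carrier ?G" for x
  proof -
    obtain u where u: "u \<in> group_words S" "x = word_class S R u"
      using \<open>x \<in> carrier ?G\<close> by (auto simp: carr)
    let ?v = "rev (map (\<lambda>(x, b). (x, \<not> b)) u)"
    have v: "?v \<in> group_words S" using u by auto
    have "word_class S R (?v @ u) = word_class S R []"
      using word_inverse[OF u(1)] u v by (subst word_class_eq_iff) auto
    then show ?thesis
      using u v by (intro bexI[of _ "word_class S R ?v"]) (auto simp only: carr one mult_word_class imageI)
  qed
qed


section \<open>Weyl groups of generalized Cartan matrices\<close>

text \<open>The Coxeter exponent \<open>m\<^sub>I\<^sub>J\<close> as a function of \<open>A\<^sub>I\<^sub>J A\<^sub>J\<^sub>I\<close>.\<close>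

definition coxeter_exponent :: "int \<Rightarrow> enat" where
  "coxeter_exponent p =
     (if p = 0 then 2 else if p = 1 then 3 else if p = 2 then 4 else if p = 3 then 6 else \<infinity>)"

text \<open>A pair with infinite exponent contributes no relator.\<close>

definition weyl_relators :: "'a set \<Rightarrow> ('a \<Rightarrow> 'a \<Rightarrow> int) \<Rightarrow> 'a group_word set" where
  "weyl_relators S A =
     {[(i, True), (i, True)] | i. i \<in> S} \<union>
     {concat (replicate k [(i, True), (j, True)]) | i j k.
        i \<in> S \<and> j \<in> S \<and> i \<noteq> j \<and> coxeter_exponent (A i j * A j i) = enat k}"

definition weyl_group :: "'a set \<Rightarrow> ('a \<Rightarrow> 'a \<Rightarrow> int) \<Rightarrow> 'a group_word set monoid" where
  "weyl_group S A = presented_group S (weyl_relators S A)"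

definition simple_reflection ::
    "'a set \<Rightarrow> ('a \<Rightarrow> 'a \<Rightarrow> int) \<Rightarrow> 'a \<Rightarrow> 'a group_word set" where
  "simple_reflection S A i = word_class S (weyl_relators S A) [(i, True)]"

definition reflection_product ::
    "'a set \<Rightarrow> ('a \<Rightarrow> 'a \<Rightarrow> int) \<Rightarrow> 'a list \<Rightarrow> 'a group_word set" where
  "reflection_product S A is =
     foldr (\<lambda>i g. simple_reflection S A i \<otimes>\<^bsub>weyl_group S A\<^esub> g) is \<one>\<^bsub>weyl_group S A\<^esub>"

definition even_weyl_group :: "'a set \<Rightarrow> ('a \<Rightarrow> 'a \<Rightarrow> int) \<Rightarrow> 'a group_word set monoid" where
  "even_weyl_group S A =
     (weyl_group S A)\<lparr>carrier := {reflection_product S A is | is. set is \<subseteq> S \<and> even (length is)}\<rparr>"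

lemma reflection_product_eq:
  assumes "set is \<subseteq> S"
  shows "reflection_product S A is = word_class S (weyl_relators S A) (map (\<lambda>i. (i, True)) is)"
  using assms
proof (induction "is")
  case Nil
  then show ?case
    by (simp add: reflection_product_def weyl_group_def presented_group_def)
next
  case (Cons i "is")
  have "reflection_product S A (i # is) =
      word_class S (weyl_relators S A) [(i, True)] \<otimes>\<^bsub>presented_group S (weyl_relators S A)\<^esub>
      word_class S (weyl_relators S A) (map (\<lambda>i. (i, True)) is)"
    using Cons by (simp add: reflection_product_def weyl_group_def simple_reflection_def)
  also have "\<dots> = word_class S (weyl_relators S A) ([(i, True)] @ map (\<lambda>i. (i, True)) is)"
    using Cons.prems by (intro mult_word_class) auto
  finally show ?case by simp
qed

lemma subgroup_even_weyl_group:
  "subgroup (carrier (even_weyl_group S A)) (weyl_group S A)"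
proof -
  let ?R = "weyl_relators S A" and ?W = "weyl_group S A"
  let ?w = "map (\<lambda>i. (i, True))"
  interpret group ?W
    unfolding weyl_group_def by (rule group_presented_group)
  have E: "carrier (even_weyl_group S A) = {word_class S ?R (?w is) | is. set is \<subseteq> S \<and> even (length is)}"
    unfolding even_weyl_group_def using reflection_product_eq[of _ S A]
    by simp metis
  have words: "?w is \<in> group_words S" if "set is \<subseteq> S" for "is"
    using that by auto
  have W: "carrier ?W = word_class S ?R ` group_words S"
    by (simp add: weyl_group_def presented_group_def)
  have one: "\<one>\<^bsub>?W\<^esub> = word_class S ?R []"
    by (simp add: weyl_group_def presented_group_def)
  have mult: "word_class S ?R u \<otimes>\<^bsub>?W\<^esub> word_class S ?R v = word_class S ?R (u @ v)"
    if "u \<in> group_words S" "v \<in> group_words S" for u v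
    using that by (simp add: weyl_group_def mult_word_class)
  have involution: "word_eq S ?R (?w (rev is) @ ?w is) []" if "set is \<subseteq> S" for "is"
    using that
  proof (induction "is")
    case Nil
    then show ?case by (simp add: word_eq.refl)
  next
    case (Cons i "is")
    have i: "i \<in> S" and isS: "set is \<subseteq> S" using Cons.prems by auto
    have wi: "?w is \<in> group_words S" "?w (rev is) \<in> group_words S"
      using isS by auto
    have "[(i, True), (i, True)] \<in> ?R" "[(i, True), (i, True)] \<in> group_words S"
      using i by (auto simp: weyl_relators_def)
    then have "word_eq S ?R [(i, True), (i, True)] []"
      by (rule word_eq.relator)
    then have "word_eq S ?R ([(i, True), (i, True)] @ ?w is) ([] @ ?w is)"
      using word_eq.refl[OF wi(1)] by (rule word_eq.append)
    then have "word_eq S ?R (?w (rev is) @ ([(i, True), (i, True)] @ ?w is)) (?w (rev is) @ ([] @ ?w is))"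
      by (rule word_eq.append[OF word_eq.refl[OF wi(2)]])
    moreover have "word_eq S ?R (?w (rev is) @ ([] @ ?w is)) []"
      using Cons.IH isS by simp
    ultimately have "word_eq S ?R (?w (rev is) @ ([(i, True), (i, True)] @ ?w is)) []"
      by (rule word_eq.trans)
    then show ?case by simp
  qed
  show ?thesis
  proof (rule subgroupI)
    show "carrier (even_weyl_group S A) \<subseteq> carrier ?W"
      using words by (auto simp: E W)
    show "carrier (even_weyl_group S A) \<noteq> {}"
      by (auto simp: E intro!: exI[of _ "[]"])
    fix a assume "a \<in> carrier (even_weyl_group S A)"
    then obtain "is" where is': "a = word_class S ?R (?w is)" "set is \<subseteq> S" "even (length is)"
      by (auto simp: E)
    have r: "set (rev is) \<subseteq> S" using is' by auto
    have "word_class S ?R (?w (rev is) @ ?w is) = word_class S ?R []"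
      using involution[OF is'(2)] words[OF r] words[OF is'(2)]
      by (subst word_class_eq_iff) auto
    then have "word_class S ?R (?w (rev is)) \<otimes>\<^bsub>?W\<^esub> a = \<one>\<^bsub>?W\<^esub>"
      using words[OF r] words[OF is'(2)] by (simp only: is'(1) mult one)
    moreover have "a \<in> carrier ?W" "word_class S ?R (?w (rev is)) \<in> carrier ?W"
      using words[OF r] words[OF is'(2)] by (simp_all only: W is'(1) imageI)
    ultimately have "inv\<^bsub>?W\<^esub> a = word_class S ?R (?w (rev is))"
      by (rule inv_equality)
    then show "inv\<^bsub>?W\<^esub> a \<in> carrier (even_weyl_group S A)"
      using r is'(3) by (auto simp: E intro!: exI[of _ "rev is"])
    fix b assume "b \<in> carrier (even_weyl_group S A)"
    then obtain js where js: "b = word_class S ?R (?w js)" "set js \<subseteq> S" "even (length js)"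
      by (auto simp: E)
    have "a \<otimes>\<^bsub>?W\<^esub> b = word_class S ?R (?w (is @ js))"
      using words[OF is'(2)] words[OF js(2)] by (simp only: is'(1) js(1) mult map_append)
    then show "a \<otimes>\<^bsub>?W\<^esub> b \<in> carrier (even_weyl_group S A)"
      using is' js unfolding E by (intro CollectI exI[of _ "is @ js"]) auto
  qed
qed


section \<open>The over-extensions of $B_8$ and $D_8$\<close>

text \<open>
  Node \<open>0\<close> is the affine node and node \<open>-1\<close> the over-extending one. Both diagrams consist of the
  chain \<open>-1, 0, \<dots>, 6\<close> with node \<open>7\<close> attached to node \<open>1\<close>, and differ in how node \<open>8\<close> is attached:
  to node \<open>5\<close> by a single line in $D_8^{++}$, and to node \<open>6\<close> by a double line in $B_8^{++}$, where
  \<open>\<alpha>\<^sub>8\<close> is the short root and \<open>A\<^sub>I\<^sub>J = 2 (\<alpha>\<^sub>I, \<alpha>\<^sub>J) / (\<alpha>\<^sub>I, \<alpha>\<^sub>I)\<close>.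
\<close>

definition nodes :: "int set" where
  "nodes = {-1..8}"

definition common_edges :: "int set set" where
  "common_edges = {{-1,0}, {0,1}, {1,2}, {2,3}, {3,4}, {4,5}, {5,6}, {1,7}}"

definition cartan_D8pp :: "int \<Rightarrow> int \<Rightarrow> int" where
  "cartan_D8pp i j =
     (if i = j then 2 else if {i, j} \<in> insert {5,8} common_edges then -1 else 0)"

definition cartan_B8pp :: "int \<Rightarrow> int \<Rightarrow> int" where
  "cartan_B8pp i j =
     (if i = j then 2
      else if (i, j) = (8, 6) then -2
      else if {i, j} \<in> insert {6,8} common_edges then -1 else 0)"

lemma coxeter_exponent_D8pp:
  assumes "i \<noteq> j"
  shows "coxeter_exponent (cartan_D8pp i j * cartan_D8pp j i) =
    (if {i, j} \<in> {{-1,0}, {0,1}, {1,2}, {2,3}, {3,4}, {4,5}, {5,6}, {1,7}, {5,8}} then 3 else 2)"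
proof -
  have "{j, i} = {i, j}"
    by auto
  then show ?thesis
    using assms by (simp add: cartan_D8pp_def common_edges_def coxeter_exponent_def)
qed

lemma coxeter_exponent_B8pp:
  assumes "i \<noteq> j"
  shows "coxeter_exponent (cartan_B8pp i j * cartan_B8pp j i) =
    (if {i, j} \<in> {{-1,0}, {0,1}, {1,2}, {2,3}, {3,4}, {4,5}, {5,6}, {1,7}} then 3
     else if {i, j} = {6,8} then 4 else 2)"
proof (cases "{i, j} = {6,8}")
  case True
  then have "i = 6 \<and> j = 8 \<or> i = 8 \<and> j = 6"
    by (simp add: doubleton_eq_iff)
  then show ?thesis
    by (elim disjE conjE)
      (simp_all add: cartan_B8pp_def common_edges_def coxeter_exponent_def doubleton_eq_iff)
next
  case False
  then have "(i, j) \<noteq> (8, 6)" "(j, i) \<noteq> (8, 6)" "{j, i} = {i, j}"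
    by auto
  then have "cartan_B8pp i j = (if {i, j} \<in> common_edges then -1 else 0)"
    and "cartan_B8pp j i = (if {i, j} \<in> common_edges then -1 else 0)"
    using assms False by (simp_all add: cartan_B8pp_def del: prod.inject)
  then show ?thesis
    using False by (simp add: common_edges_def coxeter_exponent_def)
qed


section \<open>Semidirect products with a group of order 2\<close>

text \<open>
  \<open>is_semidirect_2 G A\<close> reads \<open>G \<cong> A \<rtimes> 2\<close> for some action, as an internal decomposition of \<open>G\<close>:
  the complement \<open>H\<close> acts on the normal subgroup \<open>N\<close> by conjugation.
\<close>

definition is_semidirect_2 :: "('a, 'm) monoid_scheme \<Rightarrow> ('b, 'n) monoid_scheme \<Rightarrow> bool" where
  "is_semidirect_2 G A \<longleftrightarrow>
     (\<exists>N H. N \<lhd> G \<and> G\<lparr>carrier := N\<rparr> \<cong> A \<and> card (rcosets\<^bsub>G\<^esub> N) = 2 \<and>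
            subgroup H G \<and> card H = 2 \<and>
            N \<inter> H = {\<one>\<^bsub>G\<^esub>} \<and> N <#>\<^bsub>G\<^esub> H = carrier G)"

end

theory Submission
  imports Defs
begin

text \<open>
  Write \<open>b\<^sub>i\<close> and \<open>d\<^sub>i\<close> for the simple reflections of $B_8^{++}$ and $D_8^{++}$. The reason for the
  theorem is that $D_8^{++}$ sits inside $B_8^{++}$ as the root subsystem of the long roots: putting
  \<open>d\<^sub>i = b\<^sub>i\<close> for \<open>i \<noteq> 8\<close> and \<open>d\<^sub>8 = b\<^sub>8 b\<^sub>6 b\<^sub>8\<close> identifies \<open>W(D)\<close> with the kernel of the character of
  \<open>W(B)\<close> that counts \<open>b\<^sub>8\<close> modulo 2. The short reflection \<open>b\<^sub>8\<close> acts on this kernel by the diagram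
  automorphism that exchanges the two fork nodes 6 and 8 of $D_8^{++}$.

  Since \<open>b\<^sub>8 b\<^sub>6 b\<^sub>8\<close> has odd length, the identification preserves the parity of lengths, so
  \<open>W\<^sup>+(D)\<close> becomes the kernel of the same character on \<open>W\<^sup>+(B)\<close>. The reflection \<open>b\<^sub>8\<close> itself is odd
  and does not lie in \<open>W\<^sup>+(B)\<close>, but multiplying it by a reflection commuting with it, such as \<open>b\<^sub>0\<close>,
  gives an even involution outside the kernel, and this splits the extension
  (\<open>is_semidirect_2_kernel\<close>).

  What needs proof is that the substitution \<open>d\<^sub>i \<mapsto> b\<^sub>i\<close>, \<open>d\<^sub>8 \<mapsto> b\<^sub>8 b\<^sub>6 b\<^sub>8\<close> is injective with the whole
  kernel as image. This follows from an inverse given by Reidemeister-Schreier rewriting for the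
  transversal \<open>{1, b\<^sub>8}\<close>: move all letters \<open>b\<^sub>8\<close> of a word to its right end, where every \<open>b\<^sub>6\<close> that is
  passed by an odd number of them becomes \<open>b\<^sub>8 b\<^sub>6 b\<^sub>8 = d\<^sub>8\<close>, and vice versa. Both translations of
  words (\<open>embed_word\<close> and \<open>schreier_word\<close>) respect the relators (\<open>embed_word_cong\<close>,
  \<open>schreier_word_cong\<close>) and they are mutually inverse (\<open>schreier_embed_word\<close>, \<open>embed_schreier_word\<close>).
\<close>

section \<open>Calculating with words\<close>

lemma word_eq_group_words:
  assumes "word_eq S R u v"
  shows "u \<in> group_words S \<and> v \<in> group_words S"
  using assms by induction auto

declare word_eq.trans [trans]

lemma word_eq_context:
  assumes "word_eq S R u v" "p \<in> group_words S" "q \<in> group_words S"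
  shows "word_eq S R (p @ u @ q) (p @ v @ q)"
  using assms by (intro word_eq.append word_eq.refl)

text \<open>
  The universal property of a presentation, for a map into another presented group: it suffices
  to check the formal inverses and the relators.
\<close>

lemma word_eq_concat_map:
  assumes "word_eq S R u v"
    and words: "\<And>x b. x \<in> S \<Longrightarrow> f (x, b) \<in> group_words S'"
    and cancel: "\<And>x b. x \<in> S \<Longrightarrow> word_eq S' R' (f (x, b) @ f (x, \<not> b)) []"
    and relator: "\<And>r. r \<in> R \<Longrightarrow> r \<in> group_words S \<Longrightarrow> word_eq S' R' (concat (map f r)) []"
  shows "word_eq S' R' (concat (map f u)) (concat (map f v))"
  using assms(1)
proof induction
  case (refl u)
  then have "concat (map f u) \<in> group_words S'"
    by (induction u) (use words in auto)
  then show ?case by (rule word_eq.refl)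
qed (use cancel relator in \<open>auto intro: word_eq.intros\<close>)

text \<open>
  The function on group elements induced by a function on words. It is meaningful only when the
  latter is constant on the class, as \<open>class_map_word_class\<close> demands.
\<close>

definition class_map ::
    "('a group_word \<Rightarrow> 'b) \<Rightarrow> 'a group_word set \<Rightarrow> 'b" where
  "class_map f X = f (SOME u. u \<in> X)"

lemma class_map_word_class:
  assumes "u \<in> group_words S" "\<And>v. word_eq S R u v \<Longrightarrow> f v = f u"
  shows "class_map f (word_class S R u) = f u"
proof -
  have "u \<in> word_class S R u"
    using assms(1) by (simp add: word_class_def word_eq.refl)
  then have "(SOME v. v \<in> word_class S R u) \<in> word_class S R u"
    by (rule someI)
  then show ?thesis
    using assms(2) by (simp add: class_map_def word_class_def)
qed


section \<open>Words in simple reflections\<close>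

abbreviation weyl_eq :: "'a set \<Rightarrow> ('a \<Rightarrow> 'a \<Rightarrow> int) \<Rightarrow> 'a group_word \<Rightarrow> 'a group_word \<Rightarrow> bool" where
  "weyl_eq S A \<equiv> word_eq S (weyl_relators S A)"

lemma weyl_eq_square:
  assumes "x \<in> S"
  shows "weyl_eq S A [(x, True), (x, True)] []"
  using assms by (intro word_eq.relator) (auto simp: weyl_relators_def)

lemma weyl_eq_braid:
  assumes "i \<in> S" "j \<in> S" "i \<noteq> j" "coxeter_exponent (A i j * A j i) = enat k"
  shows "weyl_eq S A (concat (replicate k [(i, True), (j, True)])) []"
proof (rule word_eq.relator)
  show "concat (replicate k [(i, True), (j, True)]) \<in> weyl_relators S A"
    using assms unfolding weyl_relators_def by blast
  show "concat (replicate k [(i, True), (j, True)]) \<in> group_words S"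
    using assms by (auto simp: group_words_def)
qed

text \<open>
  Simple reflections are involutions, so formal inverses may be exchanged for generators at will.
  Hence an element of the Weyl group depends only on the nodes that a word visits.
\<close>

lemma weyl_eq_flip_sign:
  assumes "x \<in> S"
  shows "weyl_eq S A [(x, b)] [(x, c)]"
proof -
  have *: "weyl_eq S A [(x, False)] [(x, True)]"
  proof -
    have "weyl_eq S A ([(x, False)] @ [] @ []) ([(x, False)] @ [(x, True), (x, True)] @ [])"
      using assms by (intro word_eq_context word_eq.sym[OF weyl_eq_square]) auto
    also have "[(x, False)] @ [(x, True), (x, True)] @ [] = [] @ [(x, False), (x, \<not> False)] @ [(x, True)]"
      by simp
    also have "weyl_eq S A \<dots> ([] @ [] @ [(x, True)])"
      using assms by (intro word_eq_context word_eq.cancel) auto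
    finally show ?thesis by simp
  qed
  show ?thesis
    using * word_eq.sym[OF *] assms by (cases b; cases c) (auto intro: word_eq.refl)
qed

lemma weyl_eq_same_nodes:
  assumes "map fst u = map fst v" "u \<in> group_words S"
  shows "weyl_eq S A u v"
  using assms
proof (induction u arbitrary: v)
  case Nil
  then show ?case by (auto intro: word_eq.refl)
next
  case (Cons a u)
  then obtain b v' where v: "v = b # v'" "fst a = fst b" "map fst u = map fst v'"
    by (cases v) auto
  have "weyl_eq S A [a] [b]"
    using weyl_eq_flip_sign[of "fst b" S A "snd a" "snd b"] Cons.prems v
    by (cases a; cases b) simp
  moreover have "weyl_eq S A u v'"
    using Cons v by simp
  ultimately show ?case
    using word_eq.append[of S _ "[a]" "[b]" u v'] v by simp
qed

lemma weyl_eq_cancel: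
  assumes "x \<in> S"
  shows "weyl_eq S A [(x, b), (x, c)] []"
  using word_eq.trans[OF weyl_eq_same_nodes[of "[(x, b), (x, c)]" "[(x, True), (x, True)]"]
      weyl_eq_square] assms by auto

lemma weyl_eq_commute:
  assumes "i \<in> S" "j \<in> S" "i \<noteq> j" "coxeter_exponent (A i j * A j i) = 2"
  shows "weyl_eq S A [(i, b), (j, c)] [(j, c), (i, b)]"
proof -
  have "coxeter_exponent (A j i * A i j) = enat 2"
    using assms(4) by (simp add: mult.commute numeral_eq_enat)
  then have *: "weyl_eq S A [(j, True), (i, True), (j, True), (i, True)] []"
    using weyl_eq_braid[of j S i A 2] assms by (simp add: numeral_2_eq_2)
  have "weyl_eq S A [(j, \<not> c), (i, \<not> b), (j, c), (i, b)]
      [(j, True), (i, True), (j, True), (i, True)]"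
    using assms(1,2) by (intro weyl_eq_same_nodes) simp_all
  note relation = word_eq.trans[OF this *]
  have "weyl_eq S A ([(i, b), (j, c)] @ [] @ []) ([(i, b), (j, c)] @ [(j, \<not> c), (i, \<not> b), (j, c), (i, b)] @ [])"
    by (intro word_eq_context word_eq.sym[OF relation]) (use assms in auto)
  also have "\<dots> = [(i, b)] @ [(j, c), (j, \<not> c)] @ [(i, \<not> b), (j, c), (i, b)]"
    by simp
  also have "weyl_eq S A \<dots> ([(i, b)] @ [] @ [(i, \<not> b), (j, c), (i, b)])"
    by (intro word_eq_context word_eq.cancel) (use assms in auto)
  also have "[(i, b)] @ [] @ [(i, \<not> b), (j, c), (i, b)] = [] @ [(i, b), (i, \<not> b)] @ [(j, c), (i, b)]"
    by simp
  also have "weyl_eq S A \<dots> ([] @ [] @ [(j, c), (i, b)])"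
    by (intro word_eq_context word_eq.cancel) (use assms in auto)
  finally show ?thesis by simp
qed

text \<open>
  Allowing formal inverses in words of even length adds no elements. This is the form in which
  the translations of words apply to the even subgroup.
\<close>

lemma carrier_even_weyl_group:
  "carrier (even_weyl_group S A) =
     {word_class S (weyl_relators S A) u | u. u \<in> group_words S \<and> even (length u)}"
    (is "_ = ?E")
proof -
  have "reflection_product S A is \<in> ?E" if "set is \<subseteq> S" "even (length is)" for "is"
    using that by (auto simp: reflection_product_eq intro!: exI[of _ "map (\<lambda>i. (i, True)) is"])
  moreover have "\<exists>is. word_class S (weyl_relators S A) u = reflection_product S A is \<and>
      set is \<subseteq> S \<and> even (length is)" if "u \<in> group_words S" "even (length u)" for u
  proof (intro exI conjI)
    show *: "set (map fst u) \<subseteq> S"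
      using that by (auto simp: group_words_def)
    have "weyl_eq S A u (map (\<lambda>i. (i, True)) (map fst u))"
      by (rule weyl_eq_same_nodes) (use that in \<open>auto simp: o_def\<close>)
    then show "word_class S (weyl_relators S A) u = reflection_product S A (map fst u)"
      using that * by (subst reflection_product_eq) (simp_all only: word_class_eq_iff)
    show "even (length (map fst u))"
      using that by simp
  qed
  ultimately show ?thesis
    by (auto simp: even_weyl_group_def)
qed

lemma group_even_weyl_group: "group (even_weyl_group S A)"
proof -
  have "group ((weyl_group S A)\<lparr>carrier := carrier (even_weyl_group S A)\<rparr>)"
    by (intro subgroup.subgroup_is_group subgroup_even_weyl_group)
      (simp add: weyl_group_def group_presented_group)
  then show ?thesis
    by (simp add: even_weyl_group_def)
qed

lemma even_weyl_group_mult: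
  assumes "u \<in> group_words S" "v \<in> group_words S"
  shows "word_class S (weyl_relators S A) u \<otimes>\<^bsub>even_weyl_group S A\<^esub> word_class S (weyl_relators S A) v
    = word_class S (weyl_relators S A) (u @ v)"
  using mult_word_class[OF assms] by (simp add: even_weyl_group_def weyl_group_def)

lemma even_weyl_group_one:
  "\<one>\<^bsub>even_weyl_group S A\<^esub> = word_class S (weyl_relators S A) []"
  by (simp add: even_weyl_group_def weyl_group_def presented_group_def)


section \<open>Semidirect products from split homomorphisms\<close>

text \<open>
  An involution outside the kernel of a homomorphism onto a group of order 2 splits it off.
\<close>

lemma is_semidirect_2_kernel:
  assumes "group_hom G Z h" "card (carrier Z) = 2"
    and t: "t \<in> carrier G" "t \<otimes>\<^bsub>G\<^esub> t = \<one>\<^bsub>G\<^esub>" "h t \<noteq> \<one>\<^bsub>Z\<^esub>"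
    and iso: "G\<lparr>carrier := kernel G Z h\<rparr> \<cong> A"
  shows "is_semidirect_2 G A"
proof -
  interpret group_hom G Z h by fact
  let ?N = "kernel G Z h" and ?H = "{\<one>\<^bsub>G\<^esub>, t}"
  have t1: "t \<noteq> \<one>\<^bsub>G\<^esub>"
    using t(3) by auto
  have Z: "carrier Z = {\<one>\<^bsub>Z\<^esub>, h t}"
  proof (rule card_subset_eq[symmetric])
    show "finite (carrier Z)" using assms(2) by (simp add: card_ge_0_finite)
  qed (use t assms(2) in auto)
  have tt: "h t \<otimes>\<^bsub>Z\<^esub> h t = \<one>\<^bsub>Z\<^esub>"
    using hom_mult[OF t(1) t(1)] t(2) by simp
  have "h ` carrier G = carrier Z"
  proof
    show "h ` carrier G \<subseteq> carrier Z" by auto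
    show "carrier Z \<subseteq> h ` carrier G"
      unfolding Z using t(1) hom_one by (metis G.one_closed empty_subsetI image_eqI insert_subset)
  qed
  then have "bij_betw (\<lambda>X. the_elem (h ` X)) (carrier (G Mod ?N)) (carrier Z)"
    using FactGroup_iso_set by (auto simp: iso_def)
  then have index: "card (rcosets\<^bsub>G\<^esub> ?N) = 2"
    using bij_betw_same_card assms(2) by (fastforce simp: FactGroup_def)
  have H: "subgroup ?H G"
  proof (rule G.subgroupI)
    show "inv\<^bsub>G\<^esub> a \<in> ?H" if "a \<in> ?H" for a
      using that t G.inv_equality[of t t] by auto
  qed (use t in auto)
  \<comment> \<open>Outside the kernel, \<open>x\<close> and \<open>t\<close> have the same image, so \<open>x = (x t) t\<close> with \<open>x t\<close> in it.\<close>
  have "x \<in> ?N <#>\<^bsub>G\<^esub> ?H" if x: "x \<in> carrier G" for x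
  proof (cases "h x = \<one>\<^bsub>Z\<^esub>")
    case True
    then have "x \<in> ?N" "x = x \<otimes>\<^bsub>G\<^esub> \<one>\<^bsub>G\<^esub>"
      using x by (auto simp: kernel_def)
    then show ?thesis by (auto simp: set_mult_def)
  next
    case False
    then have "h x = h t"
      using x Z hom_closed by blast
    then have "x \<otimes>\<^bsub>G\<^esub> t \<in> ?N"
      using x t tt by (simp add: kernel_def)
    moreover have "x = (x \<otimes>\<^bsub>G\<^esub> t) \<otimes>\<^bsub>G\<^esub> t"
      using x t by (simp add: G.m_assoc)
    ultimately show ?thesis
      unfolding set_mult_def by blast
  qed
  moreover have "?N <#>\<^bsub>G\<^esub> ?H \<subseteq> carrier G"
    using t by (auto simp: set_mult_def kernel_def)
  ultimately have "?N <#>\<^bsub>G\<^esub> ?H = carrier G"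
    by blast
  moreover have "?N \<inter> ?H = {\<one>\<^bsub>G\<^esub>}"
    using t by (auto simp: kernel_def)
  ultimately show ?thesis
    unfolding is_semidirect_2_def
    using normal_kernel iso index H t1 by (intro exI[of _ ?N] exI[of _ ?H]) auto
qed

definition parity_group :: "bool monoid" where
  "parity_group = \<lparr>carrier = UNIV, mult = (\<noteq>), one = False\<rparr>"

lemma group_parity_group: "group parity_group"
  by (rule groupI) (auto simp: parity_group_def)


section \<open>Rewriting words between $B_8^{++}$ and $D_8^{++}$\<close>

abbreviation B_eq :: "int group_word \<Rightarrow> int group_word \<Rightarrow> bool" where
  "B_eq \<equiv> weyl_eq nodes cartan_B8pp"

abbreviation D_eq :: "int group_word \<Rightarrow> int group_word \<Rightarrow> bool" where
  "D_eq \<equiv> weyl_eq nodes cartan_D8pp"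

text \<open>
The automorphism of the diagram $D_8^{++}$ realised by conjugation with \<open>b\<^sub>8\<close>.
\<close>

definition fork_swap :: "int \<Rightarrow> int" where
  "fork_swap i = (if i = 6 then 8 else if i = 8 then 6 else i)"

lemma fork_swap_simps [simp]:
  "fork_swap 6 = 8" "fork_swap 8 = 6" "fork_swap (fork_swap i) = i"
  "i \<noteq> 6 \<Longrightarrow> i \<noteq> 8 \<Longrightarrow> fork_swap i = i"
  "fork_swap i \<in> nodes \<longleftrightarrow> i \<in> nodes" "fork_swap i = fork_swap j \<longleftrightarrow> i = j"
  by (auto simp: fork_swap_def nodes_def)

lemma coxeter_exponent_B8pp_eq_D8pp:
  assumes "i \<noteq> j" "i \<noteq> 8" "j \<noteq> 8"
  shows "coxeter_exponent (cartan_D8pp i j * cartan_D8pp j i) =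
         coxeter_exponent (cartan_B8pp i j * cartan_B8pp j i)"
  using assms
  by (auto simp: coxeter_exponent_D8pp coxeter_exponent_B8pp doubleton_eq_iff)

lemma coxeter_exponent_fork_swap:
  assumes "i \<noteq> j"
  shows "coxeter_exponent (cartan_D8pp (fork_swap i) (fork_swap j) * cartan_D8pp (fork_swap j) (fork_swap i)) =
         coxeter_exponent (cartan_D8pp i j * cartan_D8pp j i)"
proof -
  have "{fork_swap i, fork_swap j} \<in> {{-1,0}, {0,1}, {1,2}, {2,3}, {3,4}, {4,5}, {5,6}, {1,7}, {5,8}}
    \<longleftrightarrow> {i, j} \<in> {{-1,0}, {0,1}, {1,2}, {2,3}, {3,4}, {4,5}, {5,6}, {1,7}, {5,8}}"
    by (auto simp: fork_swap_def doubleton_eq_iff)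
  then show ?thesis
    using assms by (simp only: coxeter_exponent_D8pp fork_swap_simps not_False_eq_True)
qed

text \<open>
  The character of \<open>W(B)\<close> with value \<open>-1\<close> on the reflection in the short simple root \<open>\<alpha>\<^sub>8\<close> and \<open>1\<close> on
  the other simple reflections, written additively on words.
\<close>

definition short_parity :: "int group_word \<Rightarrow> bool" where
  "short_parity u \<longleftrightarrow> odd (length (filter (\<lambda>a. fst a = 8) u))"

lemma short_parity_simps [simp]:
  "short_parity [] = False"
  "short_parity (a # u) = ((fst a = 8) \<noteq> short_parity u)"
  "short_parity (u @ v) = (short_parity u \<noteq> short_parity v)"
  by (auto simp: short_parity_def)

text \<open>
  The flag \<open>s\<close> is the coset of the prefix read so far: whether it contains an odd number of letters 8.
  A letter 8 changes the coset and contributes nothing; any other letter contributes its conjugate by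
  the coset representative, which is a simple reflection of $D_8^{++}$.
\<close>

primrec schreier_word :: "bool \<Rightarrow> int group_word \<Rightarrow> int group_word" where
  "schreier_word s [] = []"
| "schreier_word s (a # u) =
     (if fst a = 8 then schreier_word (\<not> s) u
      else (if s then fork_swap (fst a) else fst a, snd a) # schreier_word s u)"

lemma schreier_word_append:
  "schreier_word s (u @ v) = schreier_word s u @ schreier_word (s \<noteq> short_parity u) v"
  by (induction u arbitrary: s) auto

lemma schreier_word_in_group_words:
  "u \<in> group_words nodes \<Longrightarrow> schreier_word s u \<in> group_words nodes"
  by (induction u arbitrary: s) auto

lemma even_length_schreier_word:
  "even (length (schreier_word s u)) \<longleftrightarrow> even (length u) \<noteq> short_parity u"
  by (induction u arbitrary: s) auto

text \<open>
  The formal inverse in the last letter makes the image of node 8 a conjugate as a word, so that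
  conjugations telescope in \<open>embed_word_conj\<close>.
\<close>

definition embed_word :: "int group_word \<Rightarrow> int group_word" where
  "embed_word u =
     concat (map (\<lambda>a. if fst a = 8 then [(8, True), (6, snd a), (8, False)] else [a]) u)"

lemma embed_word_simps [simp]:
  "embed_word [] = []"
  "embed_word (a # u) =
     (if fst a = 8 then [(8, True), (6, snd a), (8, False)] else [a]) @ embed_word u"
  "embed_word (u @ v) = embed_word u @ embed_word v"
  by (simp_all add: embed_word_def)

lemma embed_word_in_group_words:
  "u \<in> group_words nodes \<Longrightarrow> embed_word u \<in> group_words nodes"
  by (induction u) (auto simp: nodes_def)

lemma short_parity_embed_word [simp]: "\<not> short_parity (embed_word u)"
  by (induction u) auto

lemma even_length_embed_word: "even (length (embed_word u)) \<longleftrightarrow> even (length u)"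
  by (induction u) auto

text \<open>
  A letter 8 turns into the block 8, 6, 8, which changes the coset twice, with the 6 read as an 8 in
  between. Hence the identity holds even between words, and not just between group elements.
\<close>

lemma schreier_embed_word: "schreier_word False (embed_word u) = u"
  by (induction u) (auto simp: prod_eq_iff)

lemma schreier_word_concat_replicate:
  assumes "i \<noteq> 8" "j \<noteq> 8"
  shows "schreier_word s (concat (replicate k [(i, True), (j, True)])) =
    concat (replicate k [(if s then fork_swap i else i, True), (if s then fork_swap j else j, True)])"
  using assms by (induction k) auto

lemma short_parity_concat_replicate:
  "short_parity (concat (replicate k u)) \<longleftrightarrow> odd k \<and> short_parity u"
  by (induction k) auto

text \<open>
  A relator without the letter 8 becomes the relator of the two nodes or of their images under
  \<open>fork_swap\<close>. From \<open>(b\<^sub>i b\<^sub>8)\<^sup>2\<close>, where \<open>i\<close> is not 6, only \<open>d\<^sub>i\<^sup>2\<close> survives. The relator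
  \<open>(b\<^sub>6 b\<^sub>8)\<^sup>4\<close> becomes \<open>(d\<^sub>6 d\<^sub>8)\<^sup>2\<close>, which says that the fork nodes commute. The parity claim holds
  because all exponents at node 8 are even.
\<close>

lemma schreier_word_relator:
  assumes "r \<in> weyl_relators nodes cartan_B8pp"
  shows "D_eq (schreier_word s r) [] \<and> \<not> short_parity r"
proof -
  let ?f = "\<lambda>i. if s then fork_swap i else i"
  from assms consider
      (square) i where "i \<in> nodes" "r = [(i, True), (i, True)]"
    | (braid) i j k where "i \<in> nodes" "j \<in> nodes" "i \<noteq> j"
        "coxeter_exponent (cartan_B8pp i j * cartan_B8pp j i) = enat k"
        "r = concat (replicate k [(i, True), (j, True)])"
    unfolding weyl_relators_def by blast
  then show ?thesis
  proof cases
    case square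
    then show ?thesis
      by (auto intro: weyl_eq_cancel word_eq.refl)
  next
    case braid
    have exp2: "k = 2" if "i = 8 \<and> j \<noteq> 6 \<or> j = 8 \<and> i \<noteq> 6"
      using that braid(3,4) by (auto simp: coxeter_exponent_B8pp doubleton_eq_iff numeral_eq_enat)
    have exp4: "k = 4" if "i = 8 \<and> j = 6 \<or> j = 8 \<and> i = 6"
      using that braid(3,4) by (auto simp: coxeter_exponent_B8pp doubleton_eq_iff numeral_eq_enat)
    have fork: "D_eq (concat (replicate 2 [(a, True), (b, True)])) []"
      if "a = 6 \<and> b = 8 \<or> a = 8 \<and> b = 6" for a b
      using that by (intro weyl_eq_braid)
        (auto simp: nodes_def coxeter_exponent_D8pp numeral_eq_enat doubleton_eq_iff)
    consider "i \<noteq> 8" "j \<noteq> 8" | "i = 8 \<and> j \<noteq> 6 \<or> j = 8 \<and> i \<noteq> 6" | "i = 8 \<and> j = 6 \<or> j = 8 \<and> i = 6"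
      by blast
    then show ?thesis
    proof cases
      case 1
      have "coxeter_exponent (cartan_D8pp (?f i) (?f j) * cartan_D8pp (?f j) (?f i)) = enat k"
        using braid 1 coxeter_exponent_fork_swap[of i j] by (simp add: coxeter_exponent_B8pp_eq_D8pp)
      then have "D_eq (concat (replicate k [(?f i, True), (?f j, True)])) []"
        using braid by (intro weyl_eq_braid) auto
      then show ?thesis
        using 1 braid(5) by (simp add: schreier_word_concat_replicate short_parity_concat_replicate)
    next
      case 2
      then show ?thesis
        using braid exp2 by (auto simp: numeral_eq_Suc intro: weyl_eq_cancel)
    next
      case 3
      then show ?thesis
        using braid(5) exp4 fork[of 6 8] fork[of 8 6] by (auto simp: numeral_eq_Suc)
    qed
  qed
qed

lemma schreier_word_cong:
  assumes "B_eq u v"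
  shows "D_eq (schreier_word s u) (schreier_word s v) \<and> short_parity u = short_parity v"
  using assms
proof (induction arbitrary: s)
  case (refl u)
  then show ?case by (auto intro: word_eq.refl schreier_word_in_group_words)
next
  case (sym u v)
  then show ?case by (auto intro: word_eq.sym)
next
  case (trans u v w)
  then show ?case by (metis word_eq.trans)
next
  case (append u u' v v')
  then show ?case by (auto simp: schreier_word_append intro: word_eq.append)
next
  case (cancel x b)
  then show ?case by (auto intro: weyl_eq_cancel word_eq.refl)
next
  case (relator r)
  then show ?case using schreier_word_relator by simp
qed

lemma node_8_commute:
  assumes "x \<in> nodes" "x \<noteq> 6" "x \<noteq> 8"
  shows "B_eq [(8, b), (x, c)] [(x, c), (8, b)]"
  using assms by (intro weyl_eq_commute) (auto simp: nodes_def coxeter_exponent_B8pp doubleton_eq_iff)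

text \<open>
  The image of a node other than 6 under the embedding is the \<open>b\<^sub>8\<close>-conjugate of its partner under
  \<open>fork_swap\<close>: for node 8 by definition, for the others because they commute with \<open>b\<^sub>8\<close>. Node 6 differs: its image
  is \<open>b\<^sub>6\<close> itself, while the conjugate of its partner is \<open>b\<^sub>8 b\<^sub>8 b\<^sub>8 = b\<^sub>8\<close>.
\<close>

lemma embed_letter_conj:
  assumes "x \<in> nodes" "x \<noteq> 6"
  shows "B_eq (embed_word [(x, b)]) [(8, True), (fork_swap x, b), (8, False)]"
proof (cases "x = 8")
  case True
  then show ?thesis by (auto simp: nodes_def intro: word_eq.refl)
next
  case False
  have 8: "8 \<in> nodes" by (simp add: nodes_def)
  have "B_eq ([(x, b)] @ [] @ []) ([(x, b)] @ [(8, True), (8, False)] @ [])"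
    using assms 8 by (intro word_eq_context word_eq.sym[OF weyl_eq_cancel]) auto
  also have "\<dots> = [] @ [(x, b), (8, True)] @ [(8, False)]"
    by simp
  also have "B_eq \<dots> ([] @ [(8, True), (x, b)] @ [(8, False)])"
    using assms False 8 by (intro word_eq_context word_eq.sym[OF node_8_commute]) auto
  finally show ?thesis
    using False assms by simp
qed

lemma embed_word_conj:
  assumes "u \<in> group_words nodes" "6 \<notin> fst ` set u"
  shows "B_eq (embed_word u) ((8, True) # map (apfst fork_swap) u @ [(8, False)])"
  using assms
proof (induction u)
  case Nil
  show ?case by (auto simp: nodes_def intro: word_eq.sym[OF weyl_eq_cancel])
next
  case (Cons a u)
  have 8: "8 \<in> nodes" by (simp add: nodes_def)
  obtain x b where a: "a = (x, b)" by (cases a)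
  let ?u = "map (apfst fork_swap) u"
  have u: "?u \<in> group_words nodes"
    using Cons.prems by (auto simp: group_words_def)
  have x: "x \<in> nodes" "x \<noteq> 6"
    using Cons.prems a by auto
  have "B_eq (embed_word [(x, b)] @ embed_word u)
      ([(8, True), (fork_swap x, b), (8, False)] @ ((8, True) # ?u @ [(8, False)]))"
    using Cons x by (intro word_eq.append embed_letter_conj) auto
  also have "\<dots> = [(8, True), (fork_swap x, b)] @ [(8, False), (8, True)] @ (?u @ [(8, False)])"
    by simp
  also have "B_eq \<dots> ([(8, True), (fork_swap x, b)] @ [] @ (?u @ [(8, False)]))"
    using u x 8 by (intro word_eq_context weyl_eq_cancel) auto
  finally show ?case
    using a by simp
qed

text \<open>
  A relator without 8 is unchanged. One without 6 is, up to conjugation by \<open>b\<^sub>8\<close>, its image under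
  \<open>fork_swap\<close>, which is a relator without 8. This leaves the pair 6, 8, where \<open>(d\<^sub>6 d\<^sub>8)\<^sup>2\<close> spells out
  \<open>(b\<^sub>6 b\<^sub>8)\<^sup>4\<close>.
\<close>

lemma embed_word_relator:
  assumes "r \<in> weyl_relators nodes cartan_D8pp"
  shows "B_eq (embed_word r) []"
proof -
  have 8: "8 \<in> nodes" by (simp add: nodes_def)
  have conj: "B_eq (embed_word r) []"
    if "B_eq (map (apfst fork_swap) r) []" "6 \<notin> fst ` set r" for r
  proof -
    have "r \<in> group_words nodes"
      using word_eq_group_words[OF that(1)] by (auto simp: group_words_def image_image subset_iff)
    then have "B_eq (embed_word r) ([(8, True)] @ map (apfst fork_swap) r @ [(8, False)])"
      using embed_word_conj that(2) by simp
    also have "B_eq \<dots> ([(8, True)] @ [] @ [(8, False)])"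
      using that(1) 8 by (intro word_eq_context) auto
    also have "\<dots> = [(8, True), (8, False)]"
      by simp
    also have "B_eq \<dots> []"
      using 8 by (rule weyl_eq_cancel)
    finally show ?thesis .
  qed
  from assms consider
      (square) i where "i \<in> nodes" "r = [(i, True), (i, True)]"
    | (braid) i j k where "i \<in> nodes" "j \<in> nodes" "i \<noteq> j"
        "coxeter_exponent (cartan_D8pp i j * cartan_D8pp j i) = enat k"
        "r = concat (replicate k [(i, True), (j, True)])"
    unfolding weyl_relators_def by blast
  then show ?thesis
  proof cases
    case square
    show ?thesis
    proof (cases "i = 6")
      case True
      then show ?thesis using square by (simp add: weyl_eq_cancel)
    next
      case False
      with square show ?thesis
        by (intro conj) (auto intro: weyl_eq_cancel)
    qed
  next
    case braid
    consider "i \<noteq> 8" "j \<noteq> 8" | "i \<noteq> 6" "j \<noteq> 6" | "i = 8 \<and> j = 6 \<or> j = 8 \<and> i = 6"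
      by (cases "i = 8"; cases "j = 8") (use braid(3) in auto)
    then show ?thesis
    proof cases
      case 1
      have "embed_word r = r"
        using 1 unfolding braid(5) by (induction k) auto
      moreover have "B_eq r []"
        unfolding braid(5) using braid(1-4) 1
        by (intro weyl_eq_braid) (simp_all add: coxeter_exponent_B8pp_eq_D8pp)
      ultimately show ?thesis by simp
    next
      case 2
      have swapped: "fork_swap i \<noteq> 8" "fork_swap j \<noteq> 8"
        using 2 by (auto simp: fork_swap_def)
      have "map (apfst fork_swap) r = concat (replicate k [(fork_swap i, True), (fork_swap j, True)])"
        unfolding braid(5) by (induction k) auto
      moreover have "B_eq \<dots> []"
        using braid swapped coxeter_exponent_fork_swap[of i j]
        by (intro weyl_eq_braid) (simp_all add: coxeter_exponent_B8pp_eq_D8pp)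
      moreover have "6 \<notin> fst ` set r"
        using 2 unfolding braid(5) by (auto)
      ultimately show ?thesis
        by (intro conj) simp_all
    next
      case 3
      then have k: "k = 2"
        using braid(3,4) by (auto simp: coxeter_exponent_D8pp doubleton_eq_iff numeral_eq_enat)
      have "B_eq (concat (replicate 4 [(i, True), (j, True)])) []"
        using 3 by (intro weyl_eq_braid)
          (auto simp: nodes_def coxeter_exponent_B8pp numeral_eq_enat doubleton_eq_iff)
      moreover have "B_eq (embed_word r) (concat (replicate 4 [(i, True), (j, True)]))"
      proof (rule weyl_eq_same_nodes)
        show "map fst (embed_word r) = map fst (concat (replicate 4 [(i, True), (j, True)]))"
          using 3 braid(5) k by (auto simp: numeral_eq_Suc)
        show "embed_word r \<in> group_words nodes"
          using braid(1,2,5) k by (intro embed_word_in_group_words) (simp add: numeral_eq_Suc)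
      qed
      ultimately show ?thesis
        by (metis word_eq.trans)
    qed
  qed
qed

lemma embed_word_cong:
  assumes "D_eq u v"
  shows "B_eq (embed_word u) (embed_word v)"
  unfolding embed_word_def
proof (rule word_eq_concat_map[OF assms])
  have 68: "6 \<in> nodes" "8 \<in> nodes" by (simp_all add: nodes_def)
  let ?f = "\<lambda>a. if fst a = 8 then [(8, True), (6, snd a), (8, False)] else [a]"
  fix x :: int and b
  assume x: "x \<in> nodes"
  show "?f (x, b) \<in> group_words nodes"
    using x 68 by auto
  show "B_eq (?f (x, b) @ ?f (x, \<not> b)) []"
  proof (cases "x = 6")
    case True
    then show ?thesis using x by (simp add: weyl_eq_cancel)
  next
    case False
    have "B_eq (embed_word [(x, b), (x, \<not> b)])
        ([(8, True)] @ [(fork_swap x, b), (fork_swap x, \<not> b)] @ [(8, False)])"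
      using embed_word_conj[of "[(x, b), (x, \<not> b)]"] x False by simp
    also have "B_eq \<dots> ([(8, True)] @ [] @ [(8, False)])"
      using x 68 by (intro word_eq_context weyl_eq_cancel) auto
    also have "\<dots> = [(8, True), (8, False)]"
      by simp
    also have "B_eq \<dots> []"
      using 68 by (intro weyl_eq_cancel)
    finally show ?thesis by simp
  qed
next
  fix r assume "r \<in> weyl_relators nodes cartan_D8pp"
  then show "B_eq (concat (map (\<lambda>a. if fst a = 8 then [(8, True), (6, snd a), (8, False)] else [a]) r)) []"
    using embed_word_relator by (simp add: embed_word_def)
qed

text \<open>
  Moving all letters 8 of a word to the right end, one letter of the word at a time. The last factor
  is the coset representative.
\<close>

lemma embed_schreier_word:
  assumes "u \<in> group_words nodes"
  shows "B_eq u (embed_word (schreier_word False u) @ (if short_parity u then [(8, True)] else []))"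
  using assms
proof (induction u rule: rev_induct)
  case Nil
  show ?case by (simp add: word_eq.refl)
next
  case (snoc a u)
  have 8: "8 \<in> nodes" "6 \<in> nodes" by (simp_all add: nodes_def)
  obtain x b where a: "a = (x, b)" by (cases a)
  have x: "x \<in> nodes" and u: "u \<in> group_words nodes"
    using snoc.prems a by auto
  let ?e = "embed_word (schreier_word False u)"
  let ?p = "\<lambda>p::bool. if p then [(8::int, True)] else []"
  have e: "?e \<in> group_words nodes"
    using u by (intro embed_word_in_group_words schreier_word_in_group_words)
  \<comment> \<open>The coset representative moves past one more letter.\<close>
  have step: "B_eq (?p p @ [(x, b)]) (embed_word (schreier_word p [(x, b)]) @ ?p (p \<noteq> (x = 8)))" for p
  proof (cases "x = 8")
    case True
    then show ?thesis
      using 8 by (auto intro: weyl_eq_cancel weyl_eq_flip_sign)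
  next
    case False
    show ?thesis
    proof (cases p)
      case True
      show ?thesis
      proof (cases "x = 6")
        case x6: True
        have "B_eq ([(8, True), (6, b)] @ [] @ []) ([(8, True), (6, b)] @ [(8, False), (8, True)] @ [])"
          using 8 by (intro word_eq_context word_eq.sym[OF weyl_eq_cancel]) auto
        then show ?thesis using \<open>p\<close> x6 by simp
      next
        case x6: False
        then show ?thesis
          using \<open>p\<close> x \<open>x \<noteq> 8\<close> by (simp add: node_8_commute)
      qed
    next
      case False
      then show ?thesis
        using x \<open>x \<noteq> 8\<close> by (auto intro: word_eq.refl)
    qed
  qed
  have "B_eq (u @ [(x, b)]) ((?e @ ?p (short_parity u)) @ [(x, b)])"
    using snoc.IH u x by (intro word_eq.append word_eq.refl) auto
  also have "\<dots> = ?e @ (?p (short_parity u) @ [(x, b)])"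
    by simp
  also have "B_eq \<dots> (?e @ (embed_word (schreier_word (short_parity u) [(x, b)]) @ ?p (short_parity u \<noteq> (x = 8))))"
    using e by (intro word_eq.append word_eq.refl step)
  also have "\<dots> = embed_word (schreier_word False (u @ [a])) @ ?p (short_parity (u @ [a]))"
    using a by (simp add: schreier_word_append)
  finally show ?case
    unfolding a .
qed


section \<open>The even Weyl groups\<close>

abbreviation B_class :: "int group_word \<Rightarrow> int group_word set" where
  "B_class \<equiv> word_class nodes (weyl_relators nodes cartan_B8pp)"

abbreviation D_class :: "int group_word \<Rightarrow> int group_word set" where
  "D_class \<equiv> word_class nodes (weyl_relators nodes cartan_D8pp)"

lemma class_map_short_parity:
  "u \<in> group_words nodes \<Longrightarrow> class_map short_parity (B_class u) = short_parity u"
  by (rule class_map_word_class) (auto dest: schreier_word_cong)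

lemma class_map_schreier_word:
  assumes "u \<in> group_words nodes"
  shows "class_map (\<lambda>u. D_class (schreier_word False u)) (B_class u) = D_class (schreier_word False u)"
proof (rule class_map_word_class[OF assms])
  fix v assume "B_eq u v"
  then have "D_eq (schreier_word False u) (schreier_word False v)"
    by (simp add: schreier_word_cong)
  then show "D_class (schreier_word False v) = D_class (schreier_word False u)"
    using assms by (metis word_class_eq_iff schreier_word_in_group_words)
qed

lemma short_parity_hom:
  "group_hom (even_weyl_group nodes cartan_B8pp) parity_group (class_map short_parity)"
proof (intro group_hom.intro group_hom_axioms.intro homI)
  fix X Y
  assume "X \<in> carrier (even_weyl_group nodes cartan_B8pp)"
    and "Y \<in> carrier (even_weyl_group nodes cartan_B8pp)"
  then show "class_map short_parity (X \<otimes>\<^bsub>even_weyl_group nodes cartan_B8pp\<^esub> Y) =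
      class_map short_parity X \<otimes>\<^bsub>parity_group\<^esub> class_map short_parity Y"
    by (auto simp: carrier_even_weyl_group even_weyl_group_mult class_map_short_parity parity_group_def)
qed (simp_all add: group_even_weyl_group group_parity_group, simp add: parity_group_def)

lemma kernel_short_parity:
  "kernel (even_weyl_group nodes cartan_B8pp) parity_group (class_map short_parity) =
     {B_class u | u. u \<in> group_words nodes \<and> even (length u) \<and> \<not> short_parity u}"
  by (auto simp: kernel_def carrier_even_weyl_group class_map_short_parity parity_group_def)

text \<open>
  The isomorphism is rewriting, with the embedding as inverse. It matches the even subgroups because
  rewriting a word of the kernel drops an even number of letters, while the embedding
  lengthens a word by two letters for each 8.
\<close>

lemma kernel_short_parity_iso:
  "(even_weyl_group nodes cartan_B8pp)
     \<lparr>carrier := kernel (even_weyl_group nodes cartan_B8pp) parity_group (class_map short_parity)\<rparr>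
   \<cong> even_weyl_group nodes cartan_D8pp"
    (is "?G\<lparr>carrier := ?N\<rparr> \<cong> ?D")
proof -
  let ?h = "class_map (\<lambda>u. D_class (schreier_word False u))"
  have "?h \<in> hom (?G\<lparr>carrier := ?N\<rparr>) ?D"
  proof (rule homI)
    fix X assume "X \<in> carrier (?G\<lparr>carrier := ?N\<rparr>)"
    then obtain u where u: "X = B_class u" "u \<in> group_words nodes" "even (length u)" "\<not> short_parity u"
      by (auto simp: kernel_short_parity)
    then show "?h X \<in> carrier ?D"
      by (auto simp: carrier_even_weyl_group class_map_schreier_word schreier_word_in_group_words
          even_length_schreier_word intro!: exI[of _ "schreier_word False u"])
    fix Y assume "Y \<in> carrier (?G\<lparr>carrier := ?N\<rparr>)"
    then obtain v where "Y = B_class v" "v \<in> group_words nodes"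
      by (auto simp: kernel_short_parity)
    with u show "?h (X \<otimes>\<^bsub>?G\<lparr>carrier := ?N\<rparr>\<^esub> Y) = ?h X \<otimes>\<^bsub>?D\<^esub> ?h Y"
      by (simp add: even_weyl_group_mult class_map_schreier_word schreier_word_in_group_words schreier_word_append)
  qed
  moreover have "inj_on ?h ?N"
  proof (rule inj_onI)
    fix X Y assume "X \<in> ?N" "Y \<in> ?N" and eq: "?h X = ?h Y"
    then obtain u v where
        u: "X = B_class u" "u \<in> group_words nodes" "\<not> short_parity u" and
        v: "Y = B_class v" "v \<in> group_words nodes" "\<not> short_parity v"
      by (auto simp: kernel_short_parity)
    have "D_eq (schreier_word False u) (schreier_word False v)"
      using eq u v by (simp add: class_map_schreier_word word_class_eq_iff schreier_word_in_group_words)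
    then have "B_eq (embed_word (schreier_word False u)) (embed_word (schreier_word False v))"
      by (rule embed_word_cong)
    moreover have "B_eq u (embed_word (schreier_word False u))" "B_eq v (embed_word (schreier_word False v))"
      using embed_schreier_word[of u] embed_schreier_word[of v] u v by simp_all
    ultimately have "B_eq u v"
      by (meson word_eq.sym word_eq.trans)
    then show "X = Y"
      using u v by (simp add: word_class_eq_iff)
  qed
  moreover have "?h ` ?N = carrier ?D"
  proof
    show "?h ` ?N \<subseteq> carrier ?D"
      using \<open>?h \<in> hom (?G\<lparr>carrier := ?N\<rparr>) ?D\<close> by (auto simp: hom_def)
    show "carrier ?D \<subseteq> ?h ` ?N"
    proof
      fix Y assume "Y \<in> carrier ?D"
      then obtain v where v: "Y = D_class v" "v \<in> group_words nodes" "even (length v)"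
        by (auto simp: carrier_even_weyl_group)
      then have "B_class (embed_word v) \<in> ?N"
        unfolding kernel_short_parity
        by (auto intro!: exI[of _ "embed_word v"] simp: embed_word_in_group_words even_length_embed_word)
      moreover have "?h (B_class (embed_word v)) = Y"
        using v by (simp add: class_map_schreier_word embed_word_in_group_words schreier_embed_word)
      ultimately show "Y \<in> ?h ` ?N"
        by blast
    qed
  qed
  ultimately have "?h \<in> iso (?G\<lparr>carrier := ?N\<rparr>) ?D"
    by (auto simp: iso_def bij_betw_def)
  then show ?thesis
    by (auto simp: is_iso_def)
qed

theorem proposition14:
  shows "is_semidirect_2 (even_weyl_group nodes cartan_B8pp) (even_weyl_group nodes cartan_D8pp)"
proof (rule is_semidirect_2_kernel[OF short_parity_hom _ _ _ _ kernel_short_parity_iso])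
  \<comment> \<open>Any node not joined to 8 could take the place of 0; it makes the length even.\<close>
  let ?t = "[(8, True), (0, True)] :: int group_word"
  have words: "?t \<in> group_words nodes"
    by (simp add: nodes_def)
  show "card (carrier parity_group) = 2"
    by (simp add: parity_group_def)
  show "B_class ?t \<in> carrier (even_weyl_group nodes cartan_B8pp)"
    using words by (auto simp: carrier_even_weyl_group intro!: exI[of _ ?t])
  have "B_eq (concat (replicate 2 ?t)) []"
    by (intro weyl_eq_braid) (auto simp: nodes_def coxeter_exponent_B8pp numeral_eq_enat doubleton_eq_iff)
  then have "B_eq (?t @ ?t) []"
    by (simp add: numeral_eq_Suc)
  then show "B_class ?t \<otimes>\<^bsub>even_weyl_group nodes cartan_B8pp\<^esub> B_class ?t = \<one>\<^bsub>even_weyl_group nodes cartan_B8pp\<^esub>"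
    using words by (simp only: even_weyl_group_mult even_weyl_group_one word_class_eq_iff group_words_simps)
  show "class_map short_parity (B_class ?t) \<noteq> \<one>\<^bsub>parity_group\<^esub>"
    using words by (simp add: class_map_short_parity parity_group_def)
qed

end
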